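(* Let $\mathcal{M}_i=\{m\in\mathcal{M}: i\in S_m\}$ for each $i\in\mathcal{N}_0$, and let $$\widehat{\mathcal{S}}=\{S\in\mathcal{S}:\ \text{if } i^*\in S,\ r_{i^*}<r_i,\ \text{and } \mathcal{M}_{i^*}\subseteq\mathcal{M}_i,\ \text{then } i\in S\}.$$ Then there exists an assortment in $\widehat{\mathcal{S}}$ that is optimal for the robust optimization problem $\max_{S\in\mathcal{S}}\min_{\lambda\in\mathcal{U}}\mathscr{R}^\lambda(S)$.
   Context: Products: $\mathcal{N}=\{1,\dots,n\}$, and $0$ is the no-purchase option; $\mathcal{N}_0=\mathcal{N}\cup\{0\}$. Revenues satisfy $0=r_0<r_1<\cdots<r_n$. An assortment is a subset of $\mathcal{N}_0$, and $\mathcal{S}=\{S\subseteq\mathcal{N}_0: 0\in S\}$. Data: past assortments $S_1,\dots,S_M\subseteq\mathcal{N}_0$ with index set $\mathcal{M}=\{1,\dots,M\}$, and historical sales data $v_{m,i}\in[0,1]$ ($m\in\mathcal{M}$, $i\in\mathcal{N}_0$) with $\sum_{i\in\mathcal{N}_0}v_{m,i}=1$ for each $m$ and $v_{m,i}=0$ for $i\notin S_m$. Ranking-based choice models: $\Sigma$ is the set of all rankings, i.e. bijections $\sigma:\mathcal{N}_0\to\{0,\dots,n\}$ (product $i$ is preferred to $j$ iff $\sigma(i)<\sigma(j)$). $\Delta_\Sigma$ is the set of probability distributions $\lambda=(\lambda_\sigma)_{\sigma\in\Sigma}$ on $\Sigma$. For $\lambda\in\Delta_\Sigma$ and an assortment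 $S$, $\mathscr{D}^\lambda_i(S)=\sum_{\sigma\in\Sigma}\mathbb{I}\{i=\arg\min_{j\in S}\sigma(j)\}\lambda_\sigma$ and $\mathscr{R}^\lambda(S)=\sum_{i\in\mathcal{N}_0}r_i\mathscr{D}^\lambda_i(S)$. Uncertainty set: for a radius $\eta\ge 0$ and $\|\cdot\|$ either the $\ell_1$- or $\ell_\infty$-norm, $\mathcal{U}$ is the set of $\lambda\in\Delta_\Sigma$ for which there is a vector $\epsilon=(\epsilon_{m,i})_{m\in\mathcal{M},i\in S_m}$ with $\|\epsilon\|\le\eta$ and $\mathscr{D}^\lambda_i(S_m)-v_{m,i}=\epsilon_{m,i}$ for all $m\in\mathcal{M}$, $i\in S_m$. Standing assumption: $\mathcal{U}\neq\emptyset$. *)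

theory Defs
  imports "HOL-Analysis.Analysis" "HOL-Combinatorics.Permutations"
begin

(* The products are 1, ..., n and 0 is the no-purchase option. *)

definition assortments :: "nat \<Rightarrow> nat set set" where
  "assortments n = {S. S \<subseteq> {0..n} \<and> 0 \<in> S}"

(* "permutes" also fixes every number above n, so that each bijection from {0..n} to {0..n}
   is represented by exactly one function on nat. *)
definition rankings :: "nat \<Rightarrow> (nat \<Rightarrow> nat) set" where
  "rankings n = {\<sigma>. \<sigma> permutes {0..n}}"

definition ranking_distributions :: "nat \<Rightarrow> ((nat \<Rightarrow> nat) \<Rightarrow> real) set" where
  "ranking_distributions n =
    {lam \<in> rankings n \<rightarrow>\<^sub>E {0..}. (\<Sum>\<sigma>\<in>rankings n. lam \<sigma>) = 1}"

(* A ranking is injective on {0..n}, so "is_arg_min" singles out at most one i here. *)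
definition demand :: "nat \<Rightarrow> ((nat \<Rightarrow> nat) \<Rightarrow> real) \<Rightarrow> nat set \<Rightarrow> nat \<Rightarrow> real" where
  "demand n lam S i =
    (\<Sum>\<sigma>\<in>rankings n. of_bool (is_arg_min \<sigma> (\<lambda>j. j \<in> S) i) * lam \<sigma>)"

definition revenue ::
    "nat \<Rightarrow> (nat \<Rightarrow> real) \<Rightarrow> ((nat \<Rightarrow> nat) \<Rightarrow> real) \<Rightarrow> nat set \<Rightarrow> real" where
  "revenue n r lam S = (\<Sum>i\<in>{0..n}. r i * demand n lam S i)"

(* Norms of real vectors indexed by a finite set I. *)

definition l1_norm :: "'a set \<Rightarrow> ('a \<Rightarrow> real) \<Rightarrow> real" where
  "l1_norm I e = (\<Sum>p\<in>I. \<bar>e p\<bar>)"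

(* Inserting 0 only matters for I = {}, where Max would be unspecified. *)
definition linf_norm :: "'a set \<Rightarrow> ('a \<Rightarrow> real) \<Rightarrow> real" where
  "linf_norm I e = Max (insert 0 ((\<lambda>p. \<bar>e p\<bar>) ` I))"

(* A m is the past assortment and v m the sales data for m in {1..M}. *)
definition uncertainty_set ::
    "nat \<Rightarrow> nat \<Rightarrow> (nat \<Rightarrow> nat set) \<Rightarrow> (nat \<Rightarrow> nat \<Rightarrow> real) \<Rightarrow>
     ((nat \<times> nat) set \<Rightarrow> (nat \<times> nat \<Rightarrow> real) \<Rightarrow> real) \<Rightarrow> real \<Rightarrow>
     ((nat \<Rightarrow> nat) \<Rightarrow> real) set" where
  "uncertainty_set n M A v nrm \<eta> =
    {lam \<in> ranking_distributions n. \<exists>\<epsilon>. nrm (SIGMA m:{1..M}. A m) \<epsilon> \<le> \<eta> \<and>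
       (\<forall>m\<in>{1..M}. \<forall>i\<in>A m. demand n lam (A m) i - v m i = \<epsilon> (m, i))}"

(* The minimum over U, written as an infimum; it is attained by worst_case_revenue_attained. *)
definition worst_case_revenue ::
    "nat \<Rightarrow> (nat \<Rightarrow> real) \<Rightarrow> ((nat \<Rightarrow> nat) \<Rightarrow> real) set \<Rightarrow> nat set \<Rightarrow> real" where
  "worst_case_revenue n r U S = (INF lam\<in>U. revenue n r lam S)"

definition robust_optimal ::
    "nat \<Rightarrow> (nat \<Rightarrow> real) \<Rightarrow> ((nat \<Rightarrow> nat) \<Rightarrow> real) set \<Rightarrow> nat set \<Rightarrow> bool" where
  "robust_optimal n r U S \<longleftrightarrow> is_arg_max (worst_case_revenue n r U) (\<lambda>T. T \<in> assortments n) S"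

definition offered_in :: "nat \<Rightarrow> (nat \<Rightarrow> nat set) \<Rightarrow> nat \<Rightarrow> nat set" where
  "offered_in M A i = {m \<in> {1..M}. i \<in> A m}"

definition refined_assortments ::
    "nat \<Rightarrow> nat \<Rightarrow> (nat \<Rightarrow> real) \<Rightarrow> (nat \<Rightarrow> nat set) \<Rightarrow> nat set set" where
  "refined_assortments n M r A =
    {S \<in> assortments n. \<forall>i'\<in>S. \<forall>i\<in>{0..n}.
       r i' < r i \<and> offered_in M A i' \<subseteq> offered_in M A i \<longrightarrow> i \<in> S}"

lemma finite_rankings: "finite (rankings n)"
  by (simp add: rankings_def finite_permutations)

lemma continuous_on_demand: "continuous_on X (\<lambda>lam. demand n lam S i)"
  unfolding demand_def
  by (intro continuous_on_sum continuous_on_mult continuous_on_const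
      continuous_on_subset[OF continuous_on_product_coordinates subset_UNIV])

lemma continuous_on_revenue: "continuous_on X (\<lambda>lam. revenue n r lam S)"
  unfolding revenue_def
  by (intro continuous_on_sum continuous_on_mult continuous_on_const continuous_on_demand)

lemma compact_ranking_distributions: "compact (ranking_distributions n)"
proof -
  let ?K = "\<lambda>\<sigma>. if \<sigma> \<in> rankings n then {0..1::real} else {undefined}"
  have "compactin (product_topology (\<lambda>_. euclidean) UNIV) (PiE UNIV ?K)"
    by (simp add: compactin_PiE)
  then have K: "compact (PiE UNIV ?K)"
    by (simp add: euclidean_product_topology)
  have "continuous_on UNIV (\<lambda>lam::(nat \<Rightarrow> nat) \<Rightarrow> real. \<Sum>\<sigma>\<in>rankings n. lam \<sigma>)"
    by (intro continuous_on_sum continuous_on_product_coordinates)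
  then have C: "closed {lam::(nat \<Rightarrow> nat) \<Rightarrow> real. (\<Sum>\<sigma>\<in>rankings n. lam \<sigma>) = 1}"
    by (intro closed_Collect_eq continuous_on_const)
  have "ranking_distributions n =
      PiE UNIV ?K \<inter> {lam. (\<Sum>\<sigma>\<in>rankings n. lam \<sigma>) = 1}" (is "?L = ?R")
  proof
    show "?L \<subseteq> ?R"
    proof
      fix lam assume L: "lam \<in> ?L"
      have "lam \<sigma> \<le> 1" if "\<sigma> \<in> rankings n" for \<sigma>
      proof -
        have "lam \<sigma> \<le> (\<Sum>\<sigma>\<in>rankings n. lam \<sigma>)"
          using L that
          by (intro member_le_sum) (auto simp: ranking_distributions_def finite_rankings)
        then show ?thesis using L by (simp add: ranking_distributions_def)
      qed
      then show "lam \<in> ?R"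
        using L by (auto simp: ranking_distributions_def PiE_iff extensional_def)
    qed
    show "?R \<subseteq> ?L"
    proof
      fix lam assume "lam \<in> ?R"
      then have sum1: "(\<Sum>\<sigma>\<in>rankings n. lam \<sigma>) = 1" and "\<forall>\<sigma>. lam \<sigma> \<in> ?K \<sigma>"
        by (auto simp: PiE_iff)
      then have "\<forall>\<sigma>\<in>rankings n. 0 \<le> lam \<sigma>"
        "\<forall>\<sigma>. \<sigma> \<notin> rankings n \<longrightarrow> lam \<sigma> = undefined"
        by (auto split: if_splits)
      with sum1 show "lam \<in> ?L"
        by (auto simp: ranking_distributions_def PiE_iff extensional_def)
    qed
  qed
  with K C show ?thesis by (simp add: compact_Int_closed)
qed

lemma compact_uncertainty_set:
  assumes A: "\<And>m. m \<in> {1..M} \<Longrightarrow> A m \<subseteq> {0..n}"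
    and nrm: "nrm \<in> {l1_norm, linf_norm}"
  shows "compact (uncertainty_set n M A v nrm \<eta>)"
proof -
  let ?I = "SIGMA m:{1..M}. A m"
  let ?d = "\<lambda>lam p. demand n lam (A (fst p)) (snd p) - v (fst p) (snd p)"
  have fin: "finite ?I"
    using A by (intro finite_SigmaI) (auto intro: finite_subset)
  have cong: "nrm ?I e = nrm ?I e'" if "\<And>p. p \<in> ?I \<Longrightarrow> e p = e' p" for e e'
  proof -
    have "(\<lambda>p. \<bar>e p\<bar>) ` ?I = (\<lambda>p. \<bar>e' p\<bar>) ` ?I"
      by (rule image_cong) (use that in auto)
    moreover have "(\<Sum>p\<in>?I. \<bar>e p\<bar>) = (\<Sum>p\<in>?I. \<bar>e' p\<bar>)"
      by (rule sum.cong) (use that in auto)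
    ultimately show ?thesis
      using nrm by (auto simp: l1_norm_def linf_norm_def)
  qed
  have eq: "uncertainty_set n M A v nrm \<eta> =
      ranking_distributions n \<inter> {lam. nrm ?I (?d lam) \<le> \<eta>}" (is "?L = ?R")
  proof
    show "?L \<subseteq> ?R"
    proof
      fix lam assume "lam \<in> ?L"
      then obtain \<epsilon> where l: "lam \<in> ranking_distributions n" and e: "nrm ?I \<epsilon> \<le> \<eta>"
          "\<forall>m\<in>{1..M}. \<forall>i\<in>A m. demand n lam (A m) i - v m i = \<epsilon> (m, i)"
        by (auto simp: uncertainty_set_def)
      have "nrm ?I (?d lam) = nrm ?I \<epsilon>"
        by (rule cong) (use e in auto)
      with l e show "lam \<in> ?R" by simp
    qed
    show "?R \<subseteq> ?L"
      by (auto simp: uncertainty_set_def intro!: exI[of _ "?d _"])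
  qed
  have cont: "continuous_on UNIV (\<lambda>lam. \<bar>?d lam p\<bar>)" for p
    by (intro continuous_on_rabs continuous_on_diff continuous_on_const continuous_on_demand)
  have "closed {lam. nrm ?I (?d lam) \<le> \<eta>}"
  proof (cases "nrm = l1_norm")
    case True
    then show ?thesis
      using cont by (auto simp: l1_norm_def intro!: closed_Collect_le continuous_on_sum)
  next
    case False
    then have "{lam. nrm ?I (?d lam) \<le> \<eta>} =
        {lam. 0 \<le> \<eta>} \<inter> (\<Inter>p\<in>?I. {lam. \<bar>?d lam p\<bar> \<le> \<eta>})"
      using nrm fin by (auto simp: linf_norm_def)
    moreover have "closed {lam. \<bar>?d lam p\<bar> \<le> \<eta>}" for p
      by (intro closed_Collect_le cont continuous_on_const)
    ultimately show ?thesis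
      by (simp only:) (intro closed_Int closed_INT closed_Collect_const ballI)
  qed
  then show ?thesis
    unfolding eq by (rule compact_Int_closed[OF compact_ranking_distributions])
qed

lemma worst_case_revenue_attained:
  assumes "\<And>m. m \<in> {1..M} \<Longrightarrow> A m \<subseteq> {0..n}"
    and "nrm \<in> {l1_norm, linf_norm}"
    and U: "U = uncertainty_set n M A v nrm \<eta>" "U \<noteq> {}"
  obtains lam where "lam \<in> U" "worst_case_revenue n r U S = revenue n r lam S"
    "\<And>\<mu>. \<mu> \<in> U \<Longrightarrow> revenue n r lam S \<le> revenue n r \<mu> S"
proof -
  have "compact U" unfolding U by (rule compact_uncertainty_set[OF assms(1,2)])
  then obtain lam where *: "lam \<in> U" "\<forall>\<mu>\<in>U. revenue n r lam S \<le> revenue n r \<mu> S"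
    using continuous_attains_inf[OF _ U(2) continuous_on_revenue] by blast
  then have "worst_case_revenue n r U S = revenue n r lam S"
    unfolding worst_case_revenue_def by (intro cInf_eq_minimum) auto
  with * that show ?thesis by blast
qed

end

theory Submission
  imports Defs
begin

text \<open>
  Suppose that \<open>j \<in> S\<close> violates the closure condition because of a product \<open>i \<notin> S\<close> that earns more
  and was on offer whenever \<open>j\<close> was. The key is that adding \<open>i\<close> to \<open>S\<close> cannot lower the
  worst-case revenue (\<open>worst_case_revenue_insert\<close>). An adversary facing \<open>insert i S\<close> with a
  distribution \<open>lam\<close> has a counterpart that does at least as much harm to \<open>S\<close>: in every ranking
  that puts \<open>i\<close> before \<open>j\<close>, lift \<open>j\<close> to the place directly behind \<open>i\<close> (\<open>raise_behind\<close>).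

  The data cannot detect this change (\<open>is_arg_min_raise_behind\<close>): wherever \<open>j\<close> was offered, \<open>i\<close> was
  offered too, so a customer who prefers \<open>i\<close> never bought \<open>j\<close>, neither before nor after the
  change, and the relative order of all other products stays the same. On the other hand, a
  customer who buys \<open>i\<close> from \<open>insert i S\<close> buys \<open>j\<close> from \<open>S\<close> after the change, at a smaller revenue,
  while every other customer buys the same product in both situations
  (\<open>is_arg_min_raise_behind_insert\<close>).

  It follows that an optimal assortment of largest cardinality satisfies the closure condition.
\<close>

section \<open>Raising one product behind another in a ranking\<close>

text \<open>
  The ranks strictly between those of \<open>i\<close> and \<open>j\<close> move down by one to make room for \<open>j\<close>.
\<close>
definition raise_behind :: "'a \<Rightarrow> 'a \<Rightarrow> ('a \<Rightarrow> nat) \<Rightarrow> 'a \<Rightarrow> nat" where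
  "raise_behind i j \<sigma> =
    (if \<sigma> i < \<sigma> j
     then (\<lambda>k. if k = j then Suc (\<sigma> i) else if \<sigma> i < \<sigma> k \<and> \<sigma> k < \<sigma> j then Suc (\<sigma> k) else \<sigma> k)
     else \<sigma>)"

lemma inj_raise_behind:
  assumes "inj \<sigma>"
  shows "inj (raise_behind i j \<sigma>)"
proof (rule injI)
  fix x y assume "raise_behind i j \<sigma> x = raise_behind i j \<sigma> y"
  moreover have "\<sigma> x = \<sigma> y \<longleftrightarrow> x = y" "\<sigma> x = \<sigma> j \<longleftrightarrow> x = j" "\<sigma> y = \<sigma> j \<longleftrightarrow> y = j"
    using assms by (auto dest: injD)
  ultimately show "x = y"
    unfolding raise_behind_def by (simp split: if_splits)
qed

lemma raise_behind_in_rankings: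
  assumes \<sigma>: "\<sigma> \<in> rankings n" and i: "i \<le> n" and j: "j \<le> n"
  shows "raise_behind i j \<sigma> \<in> rankings n"
proof -
  have perm: "\<sigma> permutes {0..n}" using \<sigma> by (simp add: rankings_def)
  have rank: "\<sigma> k \<le> n \<longleftrightarrow> k \<le> n" for k
    using permutes_in_image[OF perm, of k] by simp
  have fixed: "\<sigma> k = k" if "\<not> k \<le> n" for k
    using perm that by (intro permutes_not_in) auto
  have "raise_behind i j \<sigma> k \<le> n" if "k \<le> n" for k
    using rank[of i] rank[of j] rank[of k] i j that by (simp add: raise_behind_def)
  then have "raise_behind i j \<sigma> ` {0..n} \<subseteq> {0..n}" by auto
  moreover have "inj_on (raise_behind i j \<sigma>) {0..n}"
    using inj_raise_behind[OF permutes_inj[OF perm]] by (rule inj_on_subset) simp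
  ultimately have "bij_betw (raise_behind i j \<sigma>) {0..n} {0..n}"
    by (simp add: bij_betw_def endo_inj_surj)
  moreover have "raise_behind i j \<sigma> k = k" if "k \<notin> {0..n}" for k
    using that fixed[of k] rank[of j] j by (auto simp: raise_behind_def)
  ultimately show ?thesis
    unfolding rankings_def using bij_imp_permutes by blast
qed

lemma raise_behind_less_iff:
  assumes "inj \<sigma>" "x \<noteq> j" "y \<noteq> j"
  shows "raise_behind i j \<sigma> x < raise_behind i j \<sigma> y \<longleftrightarrow> \<sigma> x < \<sigma> y"
proof -
  have "\<sigma> x \<noteq> \<sigma> j" "\<sigma> y \<noteq> \<sigma> j" using assms by (auto dest: injD)
  then show ?thesis using assms(2,3) by (auto simp: raise_behind_def)
qed

text \<open>
  In a set that contains \<open>i\<close> along with \<open>j\<close>, a raised \<open>j\<close> remains beaten by \<open>i\<close>; in a set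
  without \<open>j\<close>, only the unchanged order of the other elements matters.
\<close>
lemma is_arg_min_raise_behind:
  assumes inj: "inj \<sigma>" and T: "j \<in> T \<Longrightarrow> i \<in> T"
  shows "is_arg_min (raise_behind i j \<sigma>) (\<lambda>x. x \<in> T) k \<longleftrightarrow> is_arg_min \<sigma> (\<lambda>x. x \<in> T) k"
proof (cases "\<sigma> i < \<sigma> j")
  case False
  then show ?thesis by (simp add: raise_behind_def)
next
  case True
  let ?\<rho> = "raise_behind i j \<sigma>"
  have "i \<noteq> j" using True by auto
  have behind: "?\<rho> j = Suc (?\<rho> i)" using True \<open>i \<noteq> j\<close> by (simp add: raise_behind_def)
  note less = raise_behind_less_iff[OF inj, of _ j _ i]
  show ?thesis
  proof (cases "j \<in> T")
    case False
    then have "?\<rho> x < ?\<rho> y \<longleftrightarrow> \<sigma> x < \<sigma> y" if "x \<in> T" "y \<in> T" for x y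
      using that by (intro less) auto
    then show ?thesis by (auto simp: is_arg_min_def)
  next
    case jT: True
    then have iT: "i \<in> T" by (rule T)
    show ?thesis
    proof (cases "k = j")
      case True
      with iT behind \<open>\<sigma> i < \<sigma> j\<close> show ?thesis
        by (auto simp: is_arg_min_def)
    next
      case False
      \<comment> \<open>Whoever is beaten by \<open>j\<close> is beaten by \<open>i\<close>, so \<open>j\<close> may be dropped from the competition.\<close>
      have "(\<exists>y. y \<in> T \<and> f y < f k) \<longleftrightarrow> (\<exists>y. y \<in> T \<and> y \<noteq> j \<and> f y < f k)"
        if "f i < f j" for f :: "'a \<Rightarrow> nat"
        using that iT \<open>i \<noteq> j\<close> less_trans[OF that] by metis
      from this[of ?\<rho>] this[of \<sigma>] show ?thesis
        unfolding is_arg_min_def using behind True less False by auto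
    qed
  qed
qed

text \<open>
  If \<open>i\<close> is the best element of \<open>insert i S\<close>, then after the change nothing else in \<open>S\<close> ranks
  before \<open>j\<close>, which has become the direct successor of \<open>i\<close>.
\<close>
lemma is_arg_min_raise_behind_insert:
  assumes inj: "inj \<sigma>" and j: "j \<in> S" and i: "i \<notin> S"
    and c: "is_arg_min \<sigma> (\<lambda>x. x \<in> insert i S) c"
  shows "is_arg_min (raise_behind i j \<sigma>) (\<lambda>x. x \<in> S) (if c = i then j else c)"
proof -
  let ?\<rho> = "raise_behind i j \<sigma>"
  have min: "\<not> \<sigma> x < \<sigma> c" if "x \<in> insert i S" for x
    using c that by (auto simp: is_arg_min_def)
  have neq: "\<sigma> x \<noteq> \<sigma> y" if "x \<noteq> y" for x y
    using inj that by (auto dest: injD)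
  show ?thesis
  proof (cases "c = i")
    case True
    then have before: "\<sigma> i < \<sigma> x" if "x \<in> S" for x
      using min[of x] neq[of x i] that i by (metis insertCI linorder_neqE_nat)
    then have "?\<rho> j \<le> ?\<rho> x" if "x \<in> S" for x
      using before[OF that] before[OF j] by (simp add: raise_behind_def Suc_le_eq)
    with True j show ?thesis by (auto simp: is_arg_min_def not_less)
  next
    case False
    then have "\<sigma> c < \<sigma> i" using min[of i] neq[of c i] by auto
    then have "\<sigma> c = ?\<rho> c" if "c \<noteq> j" using that by (simp add: raise_behind_def)
    moreover have "?\<rho> = \<sigma>" if "c = j"
      using that \<open>\<sigma> c < \<sigma> i\<close> by (simp add: raise_behind_def)
    moreover have "\<sigma> c \<le> ?\<rho> x" if "x \<in> S" for x
      using that min[of x] \<open>\<sigma> c < \<sigma> i\<close> by (auto simp: raise_behind_def)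
    ultimately have "?\<rho> c \<le> ?\<rho> x" if "x \<in> S" for x
      using that by (metis order_refl)
    with False c show ?thesis by (auto simp: is_arg_min_def not_less)
  qed
qed

section \<open>Transporting a distribution along a map of rankings\<close>

definition pushforward ::
    "nat \<Rightarrow> ((nat \<Rightarrow> nat) \<Rightarrow> (nat \<Rightarrow> nat)) \<Rightarrow> ((nat \<Rightarrow> nat) \<Rightarrow> real) \<Rightarrow> ((nat \<Rightarrow> nat) \<Rightarrow> real)" where
  "pushforward n \<phi> lam =
    (\<lambda>\<rho>\<in>rankings n. \<Sum>\<sigma> | \<sigma> \<in> rankings n \<and> \<phi> \<sigma> = \<rho>. lam \<sigma>)"

lemma sum_pushforward:
  assumes "\<phi> \<in> rankings n \<rightarrow> rankings n"
  shows "(\<Sum>\<rho>\<in>rankings n. f \<rho> * pushforward n \<phi> lam \<rho>) = (\<Sum>\<sigma>\<in>rankings n. f (\<phi> \<sigma>) * lam \<sigma>)"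
proof -
  have "(\<Sum>\<rho>\<in>rankings n. f \<rho> * pushforward n \<phi> lam \<rho>) =
      (\<Sum>\<rho>\<in>rankings n. \<Sum>\<sigma> | \<sigma> \<in> rankings n \<and> \<phi> \<sigma> = \<rho>. f (\<phi> \<sigma>) * lam \<sigma>)"
    by (intro sum.cong) (auto simp: pushforward_def sum_distrib_left)
  also have "\<dots> = (\<Sum>\<sigma>\<in>rankings n. f (\<phi> \<sigma>) * lam \<sigma>)"
    using assms by (intro sum.group finite_rankings) auto
  finally show ?thesis .
qed

lemma pushforward_in_ranking_distributions:
  assumes "\<phi> \<in> rankings n \<rightarrow> rankings n" "lam \<in> ranking_distributions n"
  shows "pushforward n \<phi> lam \<in> ranking_distributions n"
proof -
  have "(\<Sum>\<rho>\<in>rankings n. pushforward n \<phi> lam \<rho>) = 1"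
    using sum_pushforward[OF assms(1), of "\<lambda>_. 1" lam] assms(2)
    by (simp add: ranking_distributions_def)
  moreover have "pushforward n \<phi> lam \<in> rankings n \<rightarrow>\<^sub>E {0..}"
    using assms(2) by (auto simp: pushforward_def ranking_distributions_def intro!: sum_nonneg)
  ultimately show ?thesis by (simp add: ranking_distributions_def)
qed

lemma demand_pushforward:
  assumes "\<phi> \<in> rankings n \<rightarrow> rankings n"
  shows "demand n (pushforward n \<phi> lam) S k =
    (\<Sum>\<sigma>\<in>rankings n. of_bool (is_arg_min (\<phi> \<sigma>) (\<lambda>x. x \<in> S) k) * lam \<sigma>)"
  unfolding demand_def by (rule sum_pushforward[OF assms])

lemma uncertainty_set_cong_demand:
  assumes "lam \<in> uncertainty_set n M A v nrm \<eta>" "mu \<in> ranking_distributions n"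
    and "\<And>m k. m \<in> {1..M} \<Longrightarrow> k \<in> A m \<Longrightarrow> demand n mu (A m) k = demand n lam (A m) k"
  shows "mu \<in> uncertainty_set n M A v nrm \<eta>"
  using assms by (auto simp: uncertainty_set_def)

section \<open>Revenue as an expectation over rankings\<close>

lemma is_arg_min_chosen:
  fixes \<sigma> :: "'a \<Rightarrow> nat"
  assumes "S \<noteq> {}"
  shows "is_arg_min \<sigma> (\<lambda>x. x \<in> S) (arg_min \<sigma> (\<lambda>x. x \<in> S))"
  using assms arg_min_natI[of "\<lambda>x. x \<in> S"] arg_min_nat_le[of "\<lambda>x. x \<in> S"]
  by (fastforce simp: is_arg_min_linorder)

lemma is_arg_min_iff_chosen:
  fixes \<sigma> :: "'a \<Rightarrow> nat"
  assumes "inj \<sigma>" "S \<noteq> {}"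
  shows "is_arg_min \<sigma> (\<lambda>x. x \<in> S) k \<longleftrightarrow> k = arg_min \<sigma> (\<lambda>x. x \<in> S)"
  using is_arg_min_chosen[OF assms(2), of \<sigma>] injD[OF assms(1), of k]
  by (metis antisym is_arg_min_linorder)

lemma revenue_eq_expectation:
  assumes S: "S \<subseteq> {0..n}" "S \<noteq> {}"
  shows "revenue n r lam S = (\<Sum>\<sigma>\<in>rankings n. r (arg_min \<sigma> (\<lambda>x. x \<in> S)) * lam \<sigma>)"
proof -
  have "revenue n r lam S = (\<Sum>\<sigma>\<in>rankings n. \<Sum>k\<in>{0..n}.
      r k * (of_bool (is_arg_min \<sigma> (\<lambda>x. x \<in> S) k) * lam \<sigma>))"
    unfolding revenue_def demand_def sum_distrib_left by (rule sum.swap)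
  also have "\<dots> = (\<Sum>\<sigma>\<in>rankings n. r (arg_min \<sigma> (\<lambda>x. x \<in> S)) * lam \<sigma>)"
  proof (rule sum.cong[OF refl])
    fix \<sigma> assume "\<sigma> \<in> rankings n"
    then have "inj \<sigma>" by (auto simp: rankings_def intro: permutes_inj)
    note chosen = is_arg_min_iff_chosen[OF this S(2)]
    let ?c = "arg_min \<sigma> (\<lambda>x. x \<in> S)"
    have "?c \<in> {0..n}"
      using is_arg_min_chosen[OF S(2), of \<sigma>] S(1) by (auto simp: is_arg_min_def)
    then have "(\<Sum>k\<in>{0..n}. if k = ?c then r k * lam \<sigma> else 0) = r ?c * lam \<sigma>"
      by (subst sum.delta) auto
    then show "(\<Sum>k\<in>{0..n}. r k * (of_bool (is_arg_min \<sigma> (\<lambda>x. x \<in> S) k) * lam \<sigma>)) =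
        r ?c * lam \<sigma>"
      unfolding chosen by (simp add: of_bool_def if_distrib[of "\<lambda>x. x * lam \<sigma>"]
          if_distrib[of "\<lambda>x. r _ * x"] cong: if_cong)
  qed
  finally show ?thesis .
qed

section \<open>Adding the dominating product\<close>

text \<open>
  The distribution that raises \<open>j\<close> behind \<open>i\<close> explains the data equally well, and earns no more
  from \<open>S\<close> than \<open>lam\<close> earns from \<open>insert i S\<close>.
\<close>
lemma ex_worse_distribution:
  assumes lam: "lam \<in> uncertainty_set n M A v nrm \<eta>"
    and S: "S \<subseteq> {0..n}" "j \<in> S" and i: "i \<le> n" "i \<notin> S"
    and r: "r j \<le> r i" and M: "offered_in M A j \<subseteq> offered_in M A i"
  shows "\<exists>mu \<in> uncertainty_set n M A v nrm \<eta>. revenue n r mu S \<le> revenue n r lam (insert i S)"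
proof
  let ?\<phi> = "raise_behind i j"
  let ?mu = "pushforward n ?\<phi> lam"
  have dist: "lam \<in> ranking_distributions n" using lam by (simp add: uncertainty_set_def)
  have inj: "inj \<sigma>" if "\<sigma> \<in> rankings n" for \<sigma>
    using that by (auto simp: rankings_def intro: permutes_inj)
  have \<phi>: "?\<phi> \<in> rankings n \<rightarrow> rankings n"
    using S i raise_behind_in_rankings by fastforce
  have "demand n ?mu (A m) k = demand n lam (A m) k" if "m \<in> {1..M}" for m k
  proof -
    have "j \<in> A m \<Longrightarrow> i \<in> A m" using M that by (auto simp: offered_in_def)
    then show ?thesis
      unfolding demand_pushforward[OF \<phi>] unfolding demand_def
      by (intro sum.cong refl) (simp add: is_arg_min_raise_behind inj)
  qed
  then show "?mu \<in> uncertainty_set n M A v nrm \<eta>"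
    using uncertainty_set_cong_demand[OF lam pushforward_in_ranking_distributions[OF \<phi> dist]]
    by blast

  have "S \<noteq> {}" using S by auto
  have pointwise: "r (arg_min (?\<phi> \<sigma>) (\<lambda>x. x \<in> S)) \<le> r (arg_min \<sigma> (\<lambda>x. x \<in> insert i S))"
    if "\<sigma> \<in> rankings n" for \<sigma>
  proof -
    define c where "c = arg_min \<sigma> (\<lambda>x. x \<in> insert i S)"
    have "is_arg_min \<sigma> (\<lambda>x. x \<in> insert i S) c"
      unfolding c_def by (rule is_arg_min_chosen) simp
    from is_arg_min_raise_behind_insert[OF inj[OF that] S(2) i(2) this]
    have "arg_min (?\<phi> \<sigma>) (\<lambda>x. x \<in> S) = (if c = i then j else c)"
      using is_arg_min_iff_chosen[OF inj_raise_behind[OF inj[OF that]] \<open>S \<noteq> {}\<close>] by metis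
    with r show ?thesis unfolding c_def by simp
  qed
  have "revenue n r ?mu S = (\<Sum>\<sigma>\<in>rankings n. r (arg_min (?\<phi> \<sigma>) (\<lambda>x. x \<in> S)) * lam \<sigma>)"
    using revenue_eq_expectation[OF S(1) \<open>S \<noteq> {}\<close>] sum_pushforward[OF \<phi>] by simp
  also have "\<dots> \<le> (\<Sum>\<sigma>\<in>rankings n. r (arg_min \<sigma> (\<lambda>x. x \<in> insert i S)) * lam \<sigma>)"
    using dist pointwise
    by (intro sum_mono mult_right_mono) (auto simp: ranking_distributions_def)
  also have "\<dots> = revenue n r lam (insert i S)"
    using S i by (intro revenue_eq_expectation[symmetric]) auto
  finally show "revenue n r ?mu S \<le> revenue n r lam (insert i S)" .
qed

lemma worst_case_revenue_insert:
  assumes A: "\<And>m. m \<in> {1..M} \<Longrightarrow> A m \<subseteq> {0..n}" and nrm: "nrm \<in> {l1_norm, linf_norm}"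
    and U: "U = uncertainty_set n M A v nrm \<eta>" "U \<noteq> {}"
    and S: "S \<subseteq> {0..n}" "j \<in> S" and i: "i \<le> n" "i \<notin> S"
    and r: "r j \<le> r i" and M: "offered_in M A j \<subseteq> offered_in M A i"
  shows "worst_case_revenue n r U S \<le> worst_case_revenue n r U (insert i S)"
proof -
  obtain lam where lam: "lam \<in> U"
      "worst_case_revenue n r U (insert i S) = revenue n r lam (insert i S)"
    using worst_case_revenue_attained[OF A nrm U] by metis
  obtain lam' where lam': "worst_case_revenue n r U S = revenue n r lam' S"
      "\<And>mu. mu \<in> U \<Longrightarrow> revenue n r lam' S \<le> revenue n r mu S"
    using worst_case_revenue_attained[OF A nrm U] by metis
  obtain mu where "mu \<in> U" "revenue n r mu S \<le> revenue n r lam (insert i S)"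
    using ex_worse_distribution[OF _ S i r M] lam(1) unfolding U(1) by metis
  with lam(2) lam' show ?thesis by fastforce
qed

lemma robust_optimal_iff:
  "robust_optimal n r U S \<longleftrightarrow> S \<in> assortments n \<and>
    (\<forall>T\<in>assortments n. worst_case_revenue n r U T \<le> worst_case_revenue n r U S)"
  by (auto simp: robust_optimal_def is_arg_max_linorder)

section \<open>A largest optimal assortment is refined\<close>

theorem theorem1:
  fixes n M :: nat
    and r :: "nat \<Rightarrow> real"
    and A :: "nat \<Rightarrow> nat set"
    and v :: "nat \<Rightarrow> nat \<Rightarrow> real"
    and nrm :: "(nat \<times> nat) set \<Rightarrow> (nat \<times> nat \<Rightarrow> real) \<Rightarrow> real"
    and \<eta> :: real
  assumes "r 0 = 0" and "strict_mono_on {0..n} r"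
    and "\<And>m. m \<in> {1..M} \<Longrightarrow> A m \<subseteq> {0..n}"
    and "\<And>m i. m \<in> {1..M} \<Longrightarrow> i \<in> {0..n} \<Longrightarrow> v m i \<in> {0..1}"
    and "\<And>m. m \<in> {1..M} \<Longrightarrow> (\<Sum>i\<in>{0..n}. v m i) = 1"
    and "\<And>m i. m \<in> {1..M} \<Longrightarrow> i \<in> {0..n} \<Longrightarrow> i \<notin> A m \<Longrightarrow> v m i = 0"
    and "nrm \<in> {l1_norm, linf_norm}" and "\<eta> \<ge> 0"
    and "uncertainty_set n M A v nrm \<eta> \<noteq> {}"
  shows "\<exists>S \<in> refined_assortments n M r A.
           robust_optimal n r (uncertainty_set n M A v nrm \<eta>) S"
proof -
  define U where "U = uncertainty_set n M A v nrm \<eta>"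
  have fin: "finite (assortments n)"
    by (rule finite_subset[of _ "Pow {0..n}"]) (auto simp: assortments_def)
  have "{0} \<in> assortments n" by (auto simp: assortments_def)
  then have "Max (worst_case_revenue n r U ` assortments n) \<in> worst_case_revenue n r U ` assortments n"
    by (intro Max_in finite_imageI fin) blast
  then obtain S0 where S0: "S0 \<in> assortments n"
      "Max (worst_case_revenue n r U ` assortments n) = worst_case_revenue n r U S0"
    by auto
  have "worst_case_revenue n r U T \<le> worst_case_revenue n r U S0" if "T \<in> assortments n" for T
    unfolding S0(2)[symmetric] using fin that by (intro Max_ge) auto
  with S0(1) have "robust_optimal n r U S0" unfolding robust_optimal_iff by blast
  moreover have "\<forall>S. robust_optimal n r U S \<longrightarrow> card S < Suc (Suc n)"
    using card_mono[of "{0..n}"] by (auto simp: robust_optimal_iff assortments_def less_Suc_eq_le)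
  ultimately obtain S where opt: "robust_optimal n r U S"
      and largest: "\<And>T. robust_optimal n r U T \<Longrightarrow> card T \<le> card S"
    using ex_has_greatest_nat[of "robust_optimal n r U" S0 card "Suc (Suc n)"] by blast
  have S: "S \<subseteq> {0..n}" "0 \<in> S" using opt by (auto simp: robust_optimal_iff assortments_def)
  have "i \<in> S"
    if "j \<in> S" "i \<in> {0..n}" "r j < r i" "offered_in M A j \<subseteq> offered_in M A i" for i j
  proof (rule ccontr)
    assume "i \<notin> S"
    with that S have "worst_case_revenue n r U S \<le> worst_case_revenue n r U (insert i S)"
      using assms(9) by (intro worst_case_revenue_insert[OF assms(3,7) U_def]) (auto simp: U_def)
    moreover have "insert i S \<in> assortments n" using that S by (auto simp: assortments_def)
    ultimately have "robust_optimal n r U (insert i S)"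
      using opt unfolding robust_optimal_iff by (meson order_trans)
    from largest[OF this] show False
      using \<open>i \<notin> S\<close> finite_subset[OF S(1)] by simp
  qed
  with opt show ?thesis
    unfolding U_def by (auto simp: refined_assortments_def robust_optimal_iff)
qed

end
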